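(* Let $n,k$ be positive integers, and let $\mathcal{W}$ be a Hamming intersecting collection of $k$-words on $[n]$. Then $$|\mathcal{W}|\leq n^{k-1}.$$ Also, $|\mathcal{W}|=n^{k-1}$ is attained when $\mathcal{W}$ is a trivial family.
   Context: $[n]=\{1,2,\ldots,n\}$. A $k$-word on $[n]$ is an ordered $k$-tuple $w_1\ldots w_k$ whose entries are elements of $[n]$ (repetitions allowed). For two $k$-words $W=w_1\ldots w_k$ and $V=v_1\ldots v_k$, the size of the Hamming intersection, $|W\cap_H V|$, is the number of positions $i\in\{1,\ldots,k\}$ with $w_i=v_i$. A collection $\mathcal{W}$ of distinct $k$-words is Hamming intersecting if $|W\cap_H V|\geq 1$ for all $W,V\in\mathcal{W}$. A trivial family is one consisting of all $k$-words on $[n]$ in which a fixed element $x\in[n]$ appears in a fixed position $i\in\{1,\ldots,k\}$. *)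

theory Defs
  imports Main
begin

text \<open>
  A word \<open>w\<^sub>1 \<dots> w\<^sub>k\<close> is a list, so the entry \<open>w\<^sub>i\<close> is \<open>w ! (i - 1)\<close>; the position
  \<open>i \<in> {1..k}\<close> of the mathematical text is the index \<open>i - 1 < k\<close> below.
\<close>

definition words :: "nat \<Rightarrow> nat \<Rightarrow> nat list set" where
  "words n k = {w. length w = k \<and> set w \<subseteq> {1..n}}"

text \<open>Only meant for words of equal length.\<close>

definition hamming_inter_size :: "'a list \<Rightarrow> 'a list \<Rightarrow> nat" where
  "hamming_inter_size w v = card {i. i < length w \<and> w ! i = v ! i}"

text \<open>
  The two words need not be distinct, as in the usual definition of an intersecting family.
\<close>

definition hamming_intersecting :: "nat \<Rightarrow> nat \<Rightarrow> nat list set \<Rightarrow> bool" where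
  "hamming_intersecting n k \<W> \<longleftrightarrow>
     \<W> \<subseteq> words n k \<and> (\<forall>w\<in>\<W>. \<forall>v\<in>\<W>. hamming_inter_size w v \<ge> 1)"

definition trivial_family :: "nat \<Rightarrow> nat \<Rightarrow> nat list set \<Rightarrow> bool" where
  "trivial_family n k \<W> \<longleftrightarrow>
     (\<exists>x\<in>{1..n}. \<exists>i<k. \<W> = {w \<in> words n k. w ! i = x})"

end

theory Submission
  imports Defs
begin

text \<open>
  Adding a constant modulo \<open>n\<close> to all letters splits the words into classes of \<open>n\<close> words, any two of
  which differ in every position, so an intersecting family meets each of these \<open>n\<^sup>k\<^sup>-\<^sup>1\<close>
  classes at most once. A class is encoded by the differences of the letters to the first one.
\<close>

definition shift_code :: "nat \<Rightarrow> nat list \<Rightarrow> int list" where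
  "shift_code n w = map (\<lambda>x. (int x - int (hd w)) mod int n) (tl w)"

lemma hamming_inter_size_ge_1_iff:
  "hamming_inter_size w v \<ge> 1 \<longleftrightarrow> (\<exists>i<length w. w ! i = v ! i)"
proof -
  have "finite {i. i < length w \<and> w ! i = v ! i}" by simp
  then show ?thesis
    unfolding hamming_inter_size_def by (auto simp: Suc_le_eq card_gt_0_iff)
qed

text \<open>The letters form a complete residue system modulo \<open>n\<close>: two of them differ
  by less than \<open>n\<close>, and 0 is the only multiple of \<open>n\<close> of such small
  absolute value.\<close>

lemma mod_eq_imp_eq_in_1_to_n:
  fixes x y n :: nat
  assumes "x \<in> {1..n}" "y \<in> {1..n}" and "int x mod int n = int y mod int n"
  shows "x = y"
proof -
  have "int n dvd int x - int y" using assms(3) by (simp add: mod_eq_dvd_iff)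
  moreover have "\<bar>int x - int y\<bar> < int n" using assms(1,2) by auto
  ultimately show ?thesis using dvd_imp_le_int[of "int x - int y" "int n"] by fastforce
qed

text \<open>Words with equal codes differ by a constant shift modulo \<open>n\<close>; agreement in
  a single position forces this shift to be 0.\<close>

lemma shift_code_eq_imp_eq:
  assumes w: "w \<in> words n k" and v: "v \<in> words n k"
    and code: "shift_code n w = shift_code n v"
    and inter: "hamming_inter_size w v \<ge> 1"
  shows "w = v"
proof -
  obtain i where i: "i < length w" "w ! i = v ! i"
    using inter unfolding hamming_inter_size_ge_1_iff by blast
  have len: "length w = k" "length v = k" using w v by (auto simp: words_def)
  have range: "w ! j \<in> {1..n}" "v ! j \<in> {1..n}" if "j < k" for j
    using that w v nth_mem[of j w] nth_mem[of j v] by (auto simp: words_def simp del: nth_mem)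
  \<comment> \<open>For \<open>j = 0\<close> both differences vanish, so the code can omit this
    position; for \<open>j = Suc m\<close> they are entry \<open>m\<close> of the two codes.\<close>
  have diff: "(int (w ! j) - int (w ! 0)) mod int n = (int (v ! j) - int (v ! 0)) mod int n"
    if "j < k" for j
  proof (cases j)
    case (Suc m)
    have "w \<noteq> []" "v \<noteq> []" using len that by auto
    moreover have "shift_code n w ! m = shift_code n v ! m" using code by simp
    ultimately show ?thesis
      using that len Suc by (simp add: shift_code_def nth_tl hd_conv_nth)
  qed simp
  \<comment> \<open>Subtracting the differences at position \<open>i\<close> from the common letter
    \<open>w ! i\<close> leaves the first letters.\<close>
  have "int (w ! 0) mod int n = int (v ! 0) mod int n"
    using mod_diff_cong[OF refl diff[of i], of "int (w ! i)"] i len by simp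
  then have head: "w ! 0 = v ! 0"
    using range[of 0] i len by (intro mod_eq_imp_eq_in_1_to_n[of _ n]) auto
  have "w ! j = v ! j" if "j < k" for j
  proof (rule mod_eq_imp_eq_in_1_to_n)
    show "int (w ! j) mod int n = int (v ! j) mod int n"
      using mod_add_cong[OF diff[OF that] refl, of "int (w ! 0)"] head by simp
  qed (use range that in auto)
  then show ?thesis using len by (simp add: list_eq_iff_nth_eq)
qed

lemma card_hamming_intersecting_le:
  assumes "n \<ge> 1" and \<W>: "hamming_intersecting n k \<W>"
  shows "card \<W> \<le> n ^ (k - 1)"
proof -
  let ?C = "{xs. set xs \<subseteq> {0..<int n} \<and> length xs = k - 1}"
  \<comment> \<open>Any two members of the family agree somewhere, so no two distinct ones share a
    code.\<close>
  have "inj_on (shift_code n) \<W>"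
    using \<W> shift_code_eq_imp_eq unfolding hamming_intersecting_def inj_on_def by blast
  moreover have "shift_code n ` \<W> \<subseteq> ?C"
    using assms by (auto simp: hamming_intersecting_def words_def shift_code_def)
  ultimately have "card \<W> \<le> card ?C"
    by (rule card_inj_on_le) (simp add: finite_lists_length_eq)
  then show ?thesis by (simp add: card_lists_length_eq)
qed

text \<open>Deleting the prescribed letter at index \<open>i\<close> loses no information: inserting
  \<open>x\<close> there again is the inverse map.\<close>

lemma card_words_fixed_letter:
  assumes "x \<in> {1..n}" "i < k"
  shows "card {w \<in> words n k. w ! i = x} = n ^ (k - 1)"
proof -
  let ?C = "{xs. set xs \<subseteq> {1..n} \<and> length xs = k - 1}"
  have "bij_betw (\<lambda>w. take i w @ drop (Suc i) w) {w \<in> words n k. w ! i = x} ?C"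
  proof (rule bij_betw_byWitness[where f' = "\<lambda>u. take i u @ x # drop i u"])
    show "\<forall>w\<in>{w \<in> words n k. w ! i = x}.
        take i (take i w @ drop (Suc i) w) @ x # drop i (take i w @ drop (Suc i) w) = w"
      using assms by (auto simp: words_def id_take_nth_drop[symmetric])
    show "(\<lambda>w. take i w @ drop (Suc i) w) ` {w \<in> words n k. w ! i = x} \<subseteq> ?C"
      using assms by (auto simp: words_def dest!: in_set_takeD in_set_dropD)
    \<comment> \<open>Since \<open>i\<close> is at most \<open>k - 1\<close>, the length of
      \<open>u\<close>, the prefix \<open>take i u\<close> has length exactly \<open>i\<close> and
      \<open>x\<close> lands at index \<open>i\<close>.\<close>
    show "(\<lambda>u. take i u @ x # drop i u) ` ?C \<subseteq> {w \<in> words n k. w ! i = x}"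
      using assms by (auto simp: words_def nth_append dest!: in_set_takeD in_set_dropD)
  qed (use assms in auto)
  then show ?thesis using bij_betw_same_card by (fastforce simp: card_lists_length_eq)
qed

lemma trivial_family_hamming_intersecting:
  "trivial_family n k \<W> \<Longrightarrow> hamming_intersecting n k \<W>"
  unfolding trivial_family_def hamming_intersecting_def hamming_inter_size_ge_1_iff
  by (auto simp: words_def)

theorem theorem4p2:
  fixes n k :: nat
  assumes "n \<ge> 1" and "k \<ge> 1"
  shows "(\<forall>\<W>. hamming_intersecting n k \<W> \<longrightarrow> card \<W> \<le> n ^ (k - 1)) \<and>
         (\<forall>\<W>. trivial_family n k \<W> \<longrightarrow>
            hamming_intersecting n k \<W> \<and> card \<W> = n ^ (k - 1))"
  using assms card_hamming_intersecting_le trivial_family_hamming_intersecting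
    card_words_fixed_letter
  unfolding trivial_family_def by blast

end
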